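(* Let $\hbar>0$, let $H:T^*\mathbb{R}^n\to\mathbb{R}$ be smooth, and define $H^\hbar:T^*\mathbb{R}^n\times\mathrm{GL}(2n,\mathbb{R})\to\mathbb{R}$ by $$H^\hbar(z,E)=H(z)+\frac{\hbar}{4}\operatorname{Tr}(E^\top D^2_zH\,E).$$ Then $H^\hbar$ is invariant under the right $\mathrm{O}(2n)$-action $(z,E)\mapsto(z,EO)$, and $j_{\mathrm{O}}(E)=-E^\top\mathbb{J}E$ is conserved along the Hamiltonian flow of $H^\hbar$ with respect to the symplectic form $\Omega^\hbar$. In particular, a symplectic frame (one with $E^\top\mathbb{J}E=\mathbb{J}$) remains symplectic under this evolution.
   Context: $T^*\mathbb{R}^n\simeq\mathbb{R}^{2n}$ has coordinates $z=(q^1,\dots,q^n,p_1,\dots,p_n)$ and symplectic form $\omega=\sum_{\alpha=1}^n dq^\alpha\wedge dp_\alpha$; $D^2_zH$ is the Hessian matrix of $H$ at $z$; $\mathbb{J}=\begin{bmatrix}0_n & I_n\\ -I_n & 0_n\end{bmatrix}$. The frame bundle of $T^*\mathbb{R}^n$ is identified with $T^*\mathbb{R}^n\times\mathrm{GL}(2n,\mathbb{R})$ by letting $(z,E)$ correspond to the frame at $z$ whose $a$th vector is $\sum_b E_{ba}\,\partial/\partial z_b|_z$. The symplectic form is $\Omega^\hbar_{(z,E)}((v,V),(w,W))=\omega_z(v,w)+\frac{\hbar}{2}\operatorname{Tr}(V^\top\mathbb{J}W)$ for $v,w\in T_zT^*\mathbb{R}^n$ and $V,W\in\mathrm{M}_{2n}(\mathbb{R})\simeq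 T_E\mathrm{GL}(2n,\mathbb{R})$. The Hamiltonian vector field $X_{H^\hbar}$ is defined by $i_{X_{H^\hbar}}\Omega^\hbar=dH^\hbar$. *)

theory Defs
  imports "HOL-Analysis.Analysis"
begin

text \<open>Coordinates on \<open>T*\<real>\<^sup>n\<close> are indexed by \<open>'n + 'n\<close>: \<open>z $ Inl i\<close> is \<open>q\<^sup>i\<close> and \<open>z $ Inr i\<close>
  is \<open>p\<^sub>i\<close>.\<close>

type_synonym 'n phase = "real ^ ('n + 'n)"
type_synonym 'n frame = "real ^ ('n + 'n) ^ ('n + 'n)"

text \<open>\<open>C\<^sup>k\<close> functions: the derivative in every fixed direction is again \<open>C\<^bsup>k-1\<^esup>\<close>.\<close>

primrec times_cont_diff :: "nat \<Rightarrow> ('a::euclidean_space \<Rightarrow> real) \<Rightarrow> bool" where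
  "times_cont_diff 0 f \<longleftrightarrow> continuous_on UNIV f"
| "times_cont_diff (Suc k) f \<longleftrightarrow>
     (\<forall>x. f differentiable (at x)) \<and>
     (\<forall>v. times_cont_diff k (\<lambda>x. frechet_derivative f (at x) v))"

definition smooth :: "('a::euclidean_space \<Rightarrow> real) \<Rightarrow> bool" where
  "smooth f \<longleftrightarrow> (\<forall>k. times_cont_diff k f)"

definition partial_deriv :: "'m::finite \<Rightarrow> (real ^ 'm \<Rightarrow> real) \<Rightarrow> real ^ 'm \<Rightarrow> real" where
  "partial_deriv i f z = frechet_derivative f (at z) (axis i 1)"

definition hessian :: "(real ^ 'm::finite \<Rightarrow> real) \<Rightarrow> real ^ 'm \<Rightarrow> real ^ 'm ^ 'm" where
  "hessian f z = (\<chi> i j. partial_deriv i (partial_deriv j f) z)"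

definition JJ :: "('n::finite) frame" where
  "JJ = (\<chi> a b. case (a, b) of
            (Inl i, Inr j) \<Rightarrow> if i = j then 1 else 0
          | (Inr i, Inl j) \<Rightarrow> if i = j then - 1 else 0
          | _ \<Rightarrow> 0)"

definition omega :: "('n::finite) phase \<Rightarrow> 'n phase \<Rightarrow> real" where
  "omega v w = (\<Sum>i\<in>UNIV. v $ Inl i * w $ Inr i - v $ Inr i * w $ Inl i)"

text \<open>The frame bundle \<open>T*\<real>\<^sup>n \<times> GL(2n,\<real>)\<close> is an open subset of a vector space, so all its
  tangent spaces are identified with that vector space.\<close>

definition frame_bundle :: "('n::finite phase \<times> 'n frame) set" where
  "frame_bundle = UNIV \<times> {E. invertible E}"

text \<open>The form is constant in the base point \<open>(z, E)\<close>, which is therefore not an argument.\<close>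

definition Omega_hbar ::
    "real \<Rightarrow> ('n::finite) phase \<times> 'n frame \<Rightarrow> 'n phase \<times> 'n frame \<Rightarrow> real" where
  "Omega_hbar hbar X Y =
     omega (fst X) (fst Y) + hbar / 2 * trace (transpose (snd X) ** JJ ** snd Y)"

definition H_hbar ::
    "real \<Rightarrow> ('n::finite phase \<Rightarrow> real) \<Rightarrow> 'n phase \<times> 'n frame \<Rightarrow> real" where
  "H_hbar hbar H x =
     H (fst x) + hbar / 4 * trace (transpose (snd x) ** hessian H (fst x) ** snd x)"

text \<open>Defined by \<open>i\<^sub>X \<Omega> = dF\<close>; only used at points of the open set \<open>frame_bundle\<close>, where
  the derivative does not depend on the values of \<open>F\<close> outside.\<close>

definition hamiltonian_vector_field ::
    "real \<Rightarrow> ('n::finite phase \<times> 'n frame \<Rightarrow> real) \<Rightarrow> 'n phase \<times> 'n frame \<Rightarrow> 'n phase \<times> 'n frame" where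
  "hamiltonian_vector_field hbar F x =
     (THE X. \<forall>Y. Omega_hbar hbar X Y = frechet_derivative F (at x) Y)"

text \<open>Derivatives at endpoints of the interval that belong to it are one-sided.\<close>

definition integral_curve ::
    "('a::real_normed_vector \<Rightarrow> 'a) \<Rightarrow> 'a set \<Rightarrow> real set \<Rightarrow> (real \<Rightarrow> 'a) \<Rightarrow> bool" where
  "integral_curve X M I c \<longleftrightarrow>
     is_interval I \<and>
     (\<forall>t\<in>I. c t \<in> M \<and> (c has_vector_derivative X (c t)) (at t within I))"

definition j_O :: "('n::finite) frame \<Rightarrow> 'n frame" where
  "j_O E = - (transpose E ** JJ ** E)"

definition symplectic_frame :: "('n::finite) frame \<Rightarrow> bool" where
  "symplectic_frame E \<longleftrightarrow> transpose E ** JJ ** E = JJ"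

text \<open>Nondegeneracy of the symplectic form: the definite description in
  \<open>hamiltonian_vector_field\<close> has exactly one solution wherever \<open>F\<close> is differentiable.\<close>

lemma sum_UNIV_sum:
  fixes f :: "'n::finite + 'n \<Rightarrow> real"
  shows "sum f UNIV = (\<Sum>i\<in>UNIV. f (Inl i)) + (\<Sum>i\<in>UNIV. f (Inr i))"
  by (subst UNIV_sum, subst sum.union_disjoint) (auto simp: sum.reindex inj_on_def)

lemma JJ_vec:
  "(JJ *v w) $ Inl i = w $ Inr i" "(JJ *v w) $ Inr i = - (w $ Inl i)"
  by (simp_all add: matrix_vector_mult_def JJ_def sum_UNIV_sum if_distribR sum.delta sum.delta'
      if_distrib cong: if_cong)

lemma JJ_mat:
  "(JJ ** W) $ Inl i $ b = W $ Inr i $ b" "(JJ ** W) $ Inr i $ b = - (W $ Inl i $ b)"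
  by (simp_all add: matrix_matrix_mult_def JJ_def sum_UNIV_sum if_distribR sum.delta sum.delta'
      if_distrib cong: if_cong)

lemma JJ_vec_twice: "JJ *v (JJ *v w) = - w"
proof -
  have "(JJ *v (JJ *v w)) $ a = (- w) $ a" for a
    by (cases a) (simp_all add: JJ_vec)
  then show ?thesis by (simp add: vec_eq_iff)
qed

lemma JJ_mat_twice: "JJ ** (JJ ** W) = - W"
proof -
  have "(JJ ** (JJ ** W)) $ a $ b = (- W) $ a $ b" for a b
    by (cases a) (simp_all add: JJ_mat)
  then show ?thesis by (simp add: vec_eq_iff)
qed

lemma omega_JJ: "omega v w = - ((JJ *v v) \<bullet> w)"
  by (simp add: omega_def inner_vec_def sum_UNIV_sum sum_subtractf sum_negf JJ_vec)

lemma trace_JJ: "trace (transpose V ** JJ ** W) = - ((JJ ** V) \<bullet> W)"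
proof -
  have "trace (transpose V ** JJ ** W) = trace (transpose V ** (JJ ** W))"
    by (simp add: matrix_mul_assoc)
  also have "\<dots> = V \<bullet> (JJ ** W)"
    unfolding trace_def transpose_def matrix_matrix_mult_def inner_vec_def
    by (simp, rule sum.swap)
  also have "\<dots> = - ((JJ ** V) \<bullet> W)"
    by (simp add: inner_vec_def sum_UNIV_sum JJ_mat sum_negf)
  finally show ?thesis .
qed

lemma ex1_hamiltonian_vector:
  fixes L :: "('n::finite) phase \<times> 'n frame \<Rightarrow> real"
  assumes "hbar > 0" "linear L"
  shows "\<exists>!X. \<forall>Y. Omega_hbar hbar X Y = L Y"
proof -
  obtain G where G: "\<And>Y. L Y = G \<bullet> Y"
  proof
    show "L Y = adjoint L 1 \<bullet> Y" for Y
      using adjoint_works[OF assms(2), of Y 1] by (simp add: inner_commute)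
  qed
  define T :: "'n phase \<times> 'n frame \<Rightarrow> 'n phase \<times> 'n frame" where
    "T = (\<lambda>X. (- (JJ *v fst X), - (hbar / 2) *\<^sub>R (JJ ** snd X)))"
  have Om: "Omega_hbar hbar X Y = T X \<bullet> Y" for X Y
    by (simp add: Omega_hbar_def omega_JJ trace_JJ T_def inner_prod_def)
  have JJ0: "JJ ** (c *\<^sub>R W) = c *\<^sub>R (JJ ** W)" for c and W :: "'n frame"
    by (simp add: matrix_scalar_ac scalar_matrix_assoc)
  have "T (JJ *v fst G, (2 / hbar) *\<^sub>R (JJ ** snd G)) = G"
    using assms(1) by (simp add: T_def JJ_vec_twice JJ_mat_twice JJ0 prod_eq_iff)
  moreover have "X = X'" if "T X = T X'" for X X'
  proof -
    have "JJ *v fst X = JJ *v fst X'" "JJ ** snd X = JJ ** snd X'"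
      using that assms(1) by (simp_all add: T_def)
    then have "- fst X = - fst X'" "- snd X = - snd X'"
      by (metis JJ_vec_twice, metis JJ_mat_twice)
    then show ?thesis by (simp add: prod_eq_iff)
  qed
  moreover have "(\<forall>Y. Omega_hbar hbar X Y = L Y) \<longleftrightarrow> T X = G" for X
    by (metis G Om vector_eq_rdot)
  ultimately show ?thesis by metis
qed

end

theory Submission
  imports Defs
begin

text \<open>At a point \<open>(z, E)\<close> let \<open>(v, V)\<close> be the value of the Hamiltonian vector field and
  \<open>S = D\<^sup>2\<^sub>z H\<close>. Testing \<open>i\<^sub>X \<Omega> = dH\<close> against the fibre directions \<open>(0, E A)\<close> gives
  \<open>V\<^sup>T \<J> E = (G + G\<^sup>T) / 2\<close> with \<open>G = E\<^sup>T S E\<close>. The right-hand side is symmetric, whereas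
  \<open>E\<^sup>T \<J> V\<close> is minus the transpose of the left-hand side, so \<open>V\<^sup>T \<J> E + E\<^sup>T \<J> V = 0\<close>; but this
  is the derivative of \<open>E\<^sup>T \<J> E\<close> along the flow.\<close>

lemma bounded_bilinear_matrix_mult:
  "bounded_bilinear ((\<lambda>A B. A ** B) ::
    real ^ 'k::finite ^ 'm::finite \<Rightarrow> real ^ 'n::finite ^ 'k \<Rightarrow> real ^ 'n ^ 'm)"
  by (subst bilinear_conv_bounded_bilinear [symmetric])
    (simp add: bilinear_def linear_iff matrix_matrix_mult_def vec_eq_iff sum.distrib
      sum_distrib_left algebra_simps)

lemma bounded_linear_transpose:
  "bounded_linear (transpose :: real ^ 'k::finite ^ 'm::finite \<Rightarrow> real ^ 'm ^ 'k)"
  by (subst linear_conv_bounded_linear [symmetric])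
    (simp add: linear_iff transpose_def vec_eq_iff)

lemma bounded_linear_trace: "bounded_linear (trace :: real ^ 'n::finite ^ 'n \<Rightarrow> real)"
  by (subst linear_conv_bounded_linear [symmetric])
    (simp add: linear_iff trace_def sum.distrib sum_distrib_left)

text \<open>The trace pairing is the Euclidean inner product on matrices, so a matrix can be
  recovered from its traces against all \<open>A\<close>.\<close>

lemma trace_transpose_mult:
  fixes A B :: "real ^ 'n::finite ^ 'm::finite"
  shows "trace (transpose A ** B) = A \<bullet> B"
  unfolding trace_def transpose_def matrix_matrix_mult_def inner_vec_def
  by (simp, rule sum.swap)

lemma transpose_JJ: "transpose JJ = - (JJ :: 'n::finite frame)"
proof -
  have "transpose JJ $ a $ b = (- JJ :: 'n frame) $ a $ b" for a b
    by (cases a; cases b) (auto simp: transpose_def JJ_def)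
  then show ?thesis by (simp add: vec_eq_iff)
qed

lemma smooth_differentiable: "smooth f \<Longrightarrow> f differentiable at x"
  unfolding smooth_def by (metis times_cont_diff.simps(2))

lemma smooth_partial_deriv: "smooth f \<Longrightarrow> smooth (partial_deriv i f)"
  unfolding smooth_def partial_deriv_def by (metis times_cont_diff.simps(2))

text \<open>Differentiability is checked entry by entry, and each entry is again smooth. It is
  needed because \<open>H_hbar\<close> contains the Hessian, so its differential involves third
  derivatives of \<open>H\<close>.\<close>

lemma smooth_hessian_differentiable:
  assumes "smooth H"
  shows "hessian H differentiable at z"
proof -
  have "(\<lambda>z. partial_deriv i (partial_deriv j H) z) differentiable at z" for i j
    using assms by (simp add: smooth_differentiable smooth_partial_deriv)
  then show ?thesis
    by (subst differentiable_componentwise_within)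
      (auto simp: hessian_def Basis_vec_def inner_axis)
qed

text \<open>This is the product rule with three factors, kept in the shape the rule produces.
  \<open>D\<close> carries the third derivatives of \<open>H\<close> and depends only on the base
  component of \<open>Y\<close>.\<close>

lemma H_hbar_has_derivative:
  fixes H :: "'n::finite phase \<Rightarrow> real"
  assumes "(H has_derivative H') (at z)" and "(hessian H has_derivative D) (at z)"
  shows "(H_hbar hbar H has_derivative
      (\<lambda>Y. H' (fst Y) + hbar / 4 * trace (transpose E ** hessian H z ** snd Y +
        (transpose E ** D (fst Y) + transpose (snd Y) ** hessian H z) ** E))) (at (z, E))"
proof -
  note [derivative_intros] =
    bounded_bilinear.FDERIV [OF bounded_bilinear_matrix_mult]
    bounded_linear.has_derivative [OF bounded_linear_transpose]
    bounded_linear.has_derivative [OF bounded_linear_trace]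
  have H: "((\<lambda>x. H (fst x)) has_derivative (\<lambda>Y. H' (fst Y))) (at (z, E))"
    and D: "((\<lambda>x. hessian H (fst x)) has_derivative (\<lambda>Y. D (fst Y))) (at (z, E))"
    using has_derivative_compose [OF has_derivative_fst [OF has_derivative_ident]] assms
    by fastforce+
  show ?thesis
    unfolding H_hbar_def [abs_def]
    by (rule derivative_eq_intros H D refl | simp)+
qed

lemma hamiltonian_vector_field_works:
  assumes "hbar > 0" and "F differentiable at x"
  shows "Omega_hbar hbar (hamiltonian_vector_field hbar F x) Y = frechet_derivative F (at x) Y"
  using theI' [OF ex1_hamiltonian_vector [OF assms(1) linear_frechet_derivative [OF assms(2)]]]
  unfolding hamiltonian_vector_field_def by blast

lemma hamiltonian_vector_field_moment:
  fixes H :: "'n::finite phase \<Rightarrow> real" and z :: "'n phase" and E :: "'n frame"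
  assumes "hbar > 0" and "smooth H"
  defines "V \<equiv> snd (hamiltonian_vector_field hbar (H_hbar hbar H) (z, E))"
  shows "transpose V ** JJ ** E + transpose E ** JJ ** V = 0"
proof -
  interpret tr: bounded_linear "transpose :: 'n frame \<Rightarrow> 'n frame"
    by (rule bounded_linear_transpose)
  interpret mm: bounded_bilinear "(\<lambda>A B. A ** B) :: 'n frame \<Rightarrow> 'n frame \<Rightarrow> 'n frame"
    by (rule bounded_bilinear_matrix_mult)
  obtain H' D where H': "(H has_derivative H') (at z)" and D: "(hessian H has_derivative D) (at z)"
    using assms(2) smooth_differentiable smooth_hessian_differentiable
    unfolding differentiable_def by meson
  note F = H_hbar_has_derivative [OF H' D, of hbar E]
  define G where "G = transpose E ** hessian H z ** E"
  define N where "N = transpose V ** JJ ** E"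
  \<comment> \<open>A fibre direction has base component 0, so the terms in \<open>H'\<close> and in
    the third derivatives drop out.\<close>
  have zero: "H' 0 = 0" "D 0 = 0"
    using H' D by (simp_all add: has_derivative_bounded_linear linear_0 bounded_linear.linear)
  have "Omega_hbar hbar (hamiltonian_vector_field hbar (H_hbar hbar H) (z, E)) (0, E ** A) =
      H' 0 + hbar / 4 * trace (transpose E ** hessian H z ** (E ** A) +
        (transpose E ** D 0 + transpose (E ** A) ** hessian H z) ** E)" for A
    using hamiltonian_vector_field_works [OF assms(1) differentiableI [OF F]]
    by (simp flip: frechet_derivative_at [OF F])
  then have "hbar / 2 * trace (N ** A) = hbar / 4 * trace (G ** A + transpose A ** G)" for A
    by (simp add: Omega_hbar_def omega_def N_def G_def V_def zero matrix_mul_assoc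
        matrix_transpose_mul)
  then have N: "trace (N ** A) = trace (G ** A + transpose A ** G) / 2" for A
    using assms(1) by (simp add: field_simps)
  \<comment> \<open>Both traces become inner products with the arbitrary matrix \<open>A\<close>,
    which then identifies \<open>transpose N\<close>.\<close>
  have "transpose N \<bullet> A = (1 / 2) *\<^sub>R (transpose G + G) \<bullet> A" for A
    using N [of A] trace_transpose_mult [of "transpose N" A]
      trace_transpose_mult [of "transpose G" A]
      trace_transpose_mult [of A G]
    by (simp add: trace_add inner_add_left inner_commute [of A])
  then have *: "transpose N = (1 / 2) *\<^sub>R (transpose G + G)"
    using vector_eq_rdot by blast
  have "transpose (transpose N) = transpose N"
    unfolding * by (simp add: tr.scaleR tr.add add.commute)
  then have "transpose N = N"
    by simp
  \<comment> \<open>The sign comes from the antisymmetry of \<open>JJ\<close>.\<close>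
  moreover have "transpose E ** JJ ** V = - transpose N"
    by (simp add: N_def matrix_transpose_mul transpose_JJ matrix_mul_assoc
        mm.minus_left mm.minus_right)
  ultimately show ?thesis by (simp add: N_def)
qed

text \<open>By the product rule the velocity of \<open>transpose E ** JJ ** E\<close> is the sum
  shown to vanish in \<open>hamiltonian_vector_field_moment\<close>. An interval is convex, so zero
  derivative forces constancy.\<close>

lemma j_O_integral_curve:
  fixes H :: "'n::finite phase \<Rightarrow> real"
  assumes "hbar > 0" and "smooth H"
    and c: "integral_curve (hamiltonian_vector_field hbar (H_hbar hbar H)) M I c"
    and "s \<in> I" and "t \<in> I"
  shows "j_O (snd (c t)) = j_O (snd (c s))"
proof -
  let ?X = "hamiltonian_vector_field hbar (H_hbar hbar H)"
  have "((\<lambda>t. transpose (snd (c t)) ** JJ ** snd (c t)) has_vector_derivative 0) (at t within I)"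
    if "t \<in> I" for t
  proof -
    have "(c has_vector_derivative ?X (c t)) (at t within I)"
      using c that by (simp add: integral_curve_def)
    then have E: "((\<lambda>t. snd (c t)) has_vector_derivative snd (?X (c t))) (at t within I)"
      by (rule bounded_linear.has_vector_derivative [OF bounded_linear_snd])
    note ET = bounded_linear.has_vector_derivative [OF bounded_linear_transpose E]
    note ETJ = bounded_bilinear.has_vector_derivative
      [OF bounded_bilinear_matrix_mult ET has_vector_derivative_const [of JJ]]
    note bounded_bilinear.has_vector_derivative [OF bounded_bilinear_matrix_mult ETJ E]
    then show ?thesis
      \<comment> \<open>The constant factor \<open>JJ\<close> contributes a zero summand, removed by
        \<open>zero_right\<close>.\<close>
      using hamiltonian_vector_field_moment [OF assms(1,2), of "fst (c t)" "snd (c t)"]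
      by (simp add: bounded_bilinear.zero_right [OF bounded_bilinear_matrix_mult] add.commute)
  qed
  moreover have "convex I"
    using c by (simp add: integral_curve_def is_interval_convex)
  ultimately obtain C where "\<And>t. t \<in> I \<Longrightarrow> transpose (snd (c t)) ** JJ ** snd (c t) = C"
    using has_vector_derivative_zero_constant [of I] by blast
  then show ?thesis
    using \<open>s \<in> I\<close> \<open>t \<in> I\<close> by (simp add: j_O_def)
qed

text \<open>Cyclicity of the trace brings \<open>Q\<close> next to \<open>transpose Q\<close>, where
  the two cancel.\<close>

lemma H_hbar_orthogonal_invariant:
  assumes "orthogonal_matrix Q"
  shows "H_hbar hbar H (z, E ** Q) = H_hbar hbar H (z, E)"
proof -
  let ?G = "transpose E ** hessian H z ** E"
  have "trace (transpose (E ** Q) ** hessian H z ** (E ** Q)) = trace (transpose Q ** (?G ** Q))"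
    by (simp add: matrix_transpose_mul matrix_mul_assoc)
  also have "\<dots> = trace ((?G ** Q) ** transpose Q)"
    by (rule trace_mul_sym)
  also have "\<dots> = trace ?G"
    using assms by (simp add: orthogonal_matrix_def flip: matrix_mul_assoc)
  finally show ?thesis
    by (simp add: H_hbar_def)
qed

theorem mainTheorem6:
  fixes hbar :: real
    and H :: "('n::finite) phase \<Rightarrow> real"
  assumes "hbar > 0"
    and "smooth H"
  shows "(\<forall>(z, E) \<in> frame_bundle. \<forall>Q. orthogonal_matrix Q \<longrightarrow>
            H_hbar hbar H (z, E ** Q) = H_hbar hbar H (z, E))
       \<and> (\<forall>I c. integral_curve (hamiltonian_vector_field hbar (H_hbar hbar H)) frame_bundle I c \<longrightarrow>
            (\<forall>s\<in>I. \<forall>t\<in>I. j_O (snd (c t)) = j_O (snd (c s))))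
       \<and> (\<forall>I c. integral_curve (hamiltonian_vector_field hbar (H_hbar hbar H)) frame_bundle I c \<longrightarrow>
            (\<forall>s\<in>I. symplectic_frame (snd (c s)) \<longrightarrow> (\<forall>t\<in>I. symplectic_frame (snd (c t)))))"
proof (intro conjI)
  \<comment> \<open>Symplectic frames form a level set of \<open>j_O\<close>, so their preservation
    follows from conservation.\<close>
  have symplectic: "symplectic_frame E \<longleftrightarrow> j_O E = - JJ" for E :: "'n frame"
    by (simp add: symplectic_frame_def j_O_def)
  note conserved = j_O_integral_curve [OF assms]
  show "\<forall>(z, E) \<in> frame_bundle. \<forall>Q. orthogonal_matrix Q \<longrightarrow>
      H_hbar hbar H (z, E ** Q) = H_hbar hbar H (z, E)"
    by (auto simp: H_hbar_orthogonal_invariant)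
  show "\<forall>I c. integral_curve (hamiltonian_vector_field hbar (H_hbar hbar H)) frame_bundle I c \<longrightarrow>
      (\<forall>s\<in>I. \<forall>t\<in>I. j_O (snd (c t)) = j_O (snd (c s)))"
    using conserved by blast
  show "\<forall>I c. integral_curve (hamiltonian_vector_field hbar (H_hbar hbar H)) frame_bundle I c \<longrightarrow>
      (\<forall>s\<in>I. symplectic_frame (snd (c s)) \<longrightarrow> (\<forall>t\<in>I. symplectic_frame (snd (c t))))"
    unfolding symplectic using conserved by metis
qed

end
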